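(* Let $X,Z$ be normed spaces, $\Omega\subset X$, $F:\Omega\rightrightarrows\mathbb{R}$ and $G:\Omega\rightrightarrows Z$ set-valued maps, and $U\subset Z$ an open neighborhood of $0_Z$. Let $V:U\rightrightarrows\mathbb{R}$, $V(z):=F(G^{-1}(z))=\bigcup_{x\in\Omega,\ z\in G(x)}F(x)$, and assume $V(z)\neq\varnothing$ for every $z\in U$. Let $r_0\in\mathbb{R}$ be nondominated by $V(0_Z)$ with respect to $\mathbb{R}_+$, i.e. $V(0_Z)\cap(r_0-\mathbb{R}_+)\subset r_0+\mathbb{R}_+$. Let $\mathcal{S}_{r_0}$ be the set of all lower semicontinuous sublinear functions $\varphi:Z\to\mathbb{R}$ such that for every $z\in Z\setminus\{0_Z\}$ $$-\varphi(z)<r-r_0\quad\text{for all } r\in F(G^{-1}(z)).$$ Let $\Gamma_{r_0}$ be the set of all $\Delta\in P(Z,\mathbb{R})$ with: (a) $\operatorname{core}(\operatorname{Gph}(\Delta))\ne\varnothing$; (b) $\mathbb{R}_+\subseteq\Delta(0_Z)$ and $(-\mathbb{R}_+)\cap\Delta(0_Z)\subseteq\mathbb{R}_+$; (c) $\operatorname{Gph}(-\Delta)\cap[\operatorname{Gph}(V)-(0_Z,r_0)]\subseteq\{(0_Z,0)\}$. Consider the mapping $\Upsilon:\mathcal{S}_{r_0}\to\Gamma_{r_0}$ which assigns to $\varphi$ the process $\Upsilon(\varphi)\in P(Z,\mathbb{R})$ with $\operatorname{Gph}(\Upsilon(\varphi)):=\operatorname{epi}(\varphi)=\{(z,t)\in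 Z\times\mathbb{R}:\varphi(z)\le t\}$. Then: (i) $\Upsilon$ is well defined, i.e. $\Upsilon(\varphi)\in\Gamma_{r_0}$ for every $\varphi\in\mathcal{S}_{r_0}$. (ii) $\Upsilon$ is bijective. (iii) For $\varphi\in\mathcal S_{r_0}$, if $\|\Upsilon(\varphi)\|<+\infty$ (for instance, when $Z$ is a Banach space), then $\operatorname{int}(\operatorname{Gph}(\Upsilon(\varphi)))\neq\varnothing$.
   Context: All normed spaces are real. A cone is a nonempty set $K$ with $\alpha K\subset K$ for all $\alpha\ge0$. For a set-valued map $\Delta$, $\operatorname{Gph}(\Delta)=\{(z,y):y\in\Delta(z)\}$ and $(-\Delta)(z):=-\Delta(z)$. $P(Z,\mathbb{R})$ is the set of all $\Delta:Z\rightrightarrows\mathbb{R}$ whose graph is a closed convex cone and with $\Delta(z)\ne\varnothing$ for all $z\in Z$. The norm of $\Delta\in P(Z,\mathbb{R})$ is $\|\Delta\|=\sup_{z\in B_Z}\inf_{y\in\Delta(z)}|y|$, with $B_Z$ the closed unit ball. $\varphi:Z\to\mathbb{R}$ is sublinear if $\varphi(\lambda x)=\lambda\varphi(x)$ and $\varphi(x+y)\le\varphi(x)+\varphi(y)$ for all $x,y\in Z$, $\lambda\ge0$. For a subset $A$ of a vector space $E$, $\operatorname{core}(A)=\{a\in A:\forall x\in E\ \exists\delta>0,\ a+[0,\delta]x\subset A\}$. For $z\in Z$, $G^{-1}(z)=\{x\in\Omega:z\in G(x)\}$, and $F(A)=\bigcup_{x\in A}F(x)$.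
   Formalization: In (c), Gph(V) is taken with V(z)=F(G^{-1}(z)) for all z in Z rather than only z in U, matching the inequality defining S_{r_0}; with Gph(V) restricted to U while G takes values outside U, surjectivity in (ii) can fail. *)

theory Defs
  imports "HOL-Analysis.Analysis"
begin

text \<open>
  A set-valued map from a set \<open>\<Omega>\<close> is a total function into sets of which only the values
  on \<open>\<Omega>\<close> are used.
\<close>

definition Gph :: "('z \<Rightarrow> 'y set) \<Rightarrow> ('z \<times> 'y) set" where
  "Gph \<Delta> = {(z, y). y \<in> \<Delta> z}"

text \<open>
  Pointwise negation of the values. The overloaded \<open>- \<Delta>\<close> would be the complement.
\<close>

definition neg_map :: "('z \<Rightarrow> 'y::uminus set) \<Rightarrow> 'z \<Rightarrow> 'y set" where
  "neg_map \<Delta> z = uminus ` \<Delta> z"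

definition inverse_map :: "'x set \<Rightarrow> ('x \<Rightarrow> 'z set) \<Rightarrow> 'z \<Rightarrow> 'x set" where
  "inverse_map \<Omega> G z = {x \<in> \<Omega>. z \<in> G x}"

definition image_of :: "('x \<Rightarrow> 'y set) \<Rightarrow> 'x set \<Rightarrow> 'y set" where
  "image_of F A = (\<Union>x\<in>A. F x)"

text \<open>
  The formula \<open>F (G\<^sup>-\<^sup>1(z))\<close> is taken for every \<open>z\<close> of the space, matching the defining inequality
  of \<open>S_set\<close>, which ranges over all \<open>z \<noteq> 0\<close>; with a graph cut down to a smaller domain,
  \<open>Upsilon\<close> need not be surjective. Intersecting the values of \<open>G\<close> with a set \<open>U\<close>
  gives the map with domain \<open>U\<close>.
\<close>

definition value_map :: "'x set \<Rightarrow> ('x \<Rightarrow> 'y set) \<Rightarrow> ('x \<Rightarrow> 'z set) \<Rightarrow> 'z \<Rightarrow> 'y set" where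
  "value_map \<Omega> F G z = image_of F (inverse_map \<Omega> G z)"

text \<open>The library's \<^const>\<open>cone\<close> admits the empty set.\<close>

definition convex_processes :: "('z::real_normed_vector \<Rightarrow> real set) set" where
  "convex_processes =
     {\<Delta>. Gph \<Delta> \<noteq> {} \<and> cone (Gph \<Delta>) \<and> convex (Gph \<Delta>) \<and> closed (Gph \<Delta>) \<and> (\<forall>z. \<Delta> z \<noteq> {})}"

definition process_norm :: "('z::real_normed_vector \<Rightarrow> real set) \<Rightarrow> ereal" where
  "process_norm \<Delta> = (SUP z\<in>cball 0 1. INF y\<in>\<Delta> z. ereal \<bar>y\<bar>)"

definition core :: "'e::real_vector set \<Rightarrow> 'e set" where
  "core A = {a \<in> A. \<forall>x. \<exists>\<delta>>0. \<forall>t\<in>{0..\<delta>}. a + t *\<^sub>R x \<in> A}"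

definition sublinear :: "('z::real_vector \<Rightarrow> real) \<Rightarrow> bool" where
  "sublinear \<phi> \<longleftrightarrow>
     (\<forall>x. \<forall>c\<ge>0. \<phi> (c *\<^sub>R x) = c * \<phi> x) \<and> (\<forall>x y. \<phi> (x + y) \<le> \<phi> x + \<phi> y)"

definition lower_semicontinuous :: "('z::topological_space \<Rightarrow> real) \<Rightarrow> bool" where
  "lower_semicontinuous \<phi> \<longleftrightarrow> (\<forall>z. \<forall>a<\<phi> z. \<forall>\<^sub>F w in nhds z. a < \<phi> w)"

definition S_set ::
  "'x set \<Rightarrow> ('x \<Rightarrow> real set) \<Rightarrow> ('x \<Rightarrow> 'z::real_normed_vector set) \<Rightarrow> real \<Rightarrow> ('z \<Rightarrow> real) set" where
  "S_set \<Omega> F G r0 =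
     {\<phi>. lower_semicontinuous \<phi> \<and> sublinear \<phi> \<and>
         (\<forall>z. z \<noteq> 0 \<longrightarrow> (\<forall>r\<in>image_of F (inverse_map \<Omega> G z). - \<phi> z < r - r0))}"

definition Gamma_set ::
  "'x set \<Rightarrow> ('x \<Rightarrow> real set) \<Rightarrow> ('x \<Rightarrow> 'z::real_normed_vector set) \<Rightarrow> real \<Rightarrow> ('z \<Rightarrow> real set) set" where
  "Gamma_set \<Omega> F G r0 =
     {\<Delta> \<in> convex_processes.
         core (Gph \<Delta>) \<noteq> {} \<and>
         {0..} \<subseteq> \<Delta> 0 \<and> {..0} \<inter> \<Delta> 0 \<subseteq> {0..} \<and>
         Gph (neg_map \<Delta>) \<inter> (\<lambda>p. p - (0, r0)) ` Gph (value_map \<Omega> F G) \<subseteq> {(0, 0)}}"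

definition Upsilon :: "('z::real_normed_vector \<Rightarrow> real) \<Rightarrow> 'z \<Rightarrow> real set" where
  "Upsilon \<phi> z = {t. (z, t) \<in> epigraph UNIV \<phi>}"

lemma Gph_Upsilon: "Gph (Upsilon \<phi>) = epigraph UNIV \<phi>"
  by (auto simp: Gph_def Upsilon_def)

end

theory Submission
  imports Defs
begin

text \<open>
  A process \<open>\<Delta>\<close> with \<open>\<Delta> 0 = {0..}\<close> has upward closed values because the cone \<open>Gph \<Delta>\<close> is
  closed under addition. Adding an element of \<open>\<Delta> (-z)\<close> to one of \<open>\<Delta> z\<close> lands in \<open>\<Delta> 0\<close>, so
  \<open>\<Delta> z\<close> is also bounded below; being closed it is a half-line \<open>{\<phi> z..}\<close>, and \<open>\<phi>\<close> is the
  preimage of \<open>\<Delta>\<close> under \<open>Upsilon\<close>. On a Banach space the closed sets \<open>{z. \<phi> z \<le> n}\<close> cover the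
  space, so by Baire one of them contains a ball, and sublinearity carries the resulting upper
  bound over to the unit ball.
\<close>

section \<open>Values and injectivity of \<open>Upsilon\<close>\<close>

lemma mem_Upsilon: "t \<in> Upsilon \<phi> z \<longleftrightarrow> \<phi> z \<le> t"
  by (simp add: Upsilon_def mem_epigraph)

lemma inj_Upsilon: "inj Upsilon"
proof (rule injI, rule ext)
  fix \<phi> \<psi> :: "'a::real_normed_vector \<Rightarrow> real" and z
  assume "Upsilon \<phi> = Upsilon \<psi>"
  then have "\<phi> z \<le> t \<longleftrightarrow> \<psi> z \<le> t" for t
    by (metis mem_Upsilon)
  then show "\<phi> z = \<psi> z"
    by (metis order.antisym order.refl)
qed

section \<open>Sublinearity and lower semicontinuity in terms of the epigraph\<close>

lemma sublinear_scaleR: "sublinear \<phi> \<Longrightarrow> 0 \<le> c \<Longrightarrow> \<phi> (c *\<^sub>R x) = c * \<phi> x"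
  by (simp add: sublinear_def)

lemma sublinear_add: "sublinear \<phi> \<Longrightarrow> \<phi> (x + y) \<le> \<phi> x + \<phi> y"
  by (simp add: sublinear_def)

lemma sublinear_zero: "sublinear \<phi> \<Longrightarrow> \<phi> 0 = 0"
  using sublinear_scaleR[of \<phi> 0 0] by simp

text \<open>A convex cone is a set closed under sums and nonnegative multiples; on an epigraph these
  closures are subadditivity and \<open>\<phi> (c *\<^sub>R x) \<le> c * \<phi> x\<close>.\<close>

lemma convex_cone_epigraph_iff_sublinear:
  "cone (epigraph UNIV \<phi>) \<and> convex (epigraph UNIV \<phi>) \<longleftrightarrow> sublinear \<phi>"
proof
  assume "sublinear \<phi>"
  then show "cone (epigraph UNIV \<phi>) \<and> convex (epigraph UNIV \<phi>)"
    unfolding conj_commute[of "cone _"] convex_cone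
    by (auto simp: mem_epigraph sublinear_scaleR mult_left_mono
        intro!: order.trans[OF sublinear_add] add_mono)
next
  assume "cone (epigraph UNIV \<phi>) \<and> convex (epigraph UNIV \<phi>)"
  then have add: "p + q \<in> epigraph UNIV \<phi>"
    and scale: "c \<ge> 0 \<Longrightarrow> c *\<^sub>R p \<in> epigraph UNIV \<phi>"
    if "p \<in> epigraph UNIV \<phi>" "q \<in> epigraph UNIV \<phi>" for p q c
    unfolding conj_commute[of "cone _"] convex_cone using that by blast+
  have add: "\<phi> (x + y) \<le> s + t" if "\<phi> x \<le> s" "\<phi> y \<le> t" for x y s t
    using add[of "(x, s)" "(y, t)"] that by (simp add: mem_epigraph)
  have scale: "\<phi> (c *\<^sub>R x) \<le> c * s" if "\<phi> x \<le> s" "0 \<le> c" for x s c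
    using scale[of "(x, s)" "(x, s)" c] that by (simp add: mem_epigraph)
  \<comment> \<open>Doubling \<open>(0, \<phi> 0)\<close> gives
    \<open>\<phi> 0 \<le> 2 * \<phi> 0\<close>; scaling it by 0 gives the other inequality.\<close>
  have "\<phi> 0 \<ge> 0"
    using add[of 0 "\<phi> 0" 0 "\<phi> 0"] by simp
  moreover have "\<phi> 0 \<le> 0"
    using scale[of 0 "\<phi> 0" 0] by simp
  ultimately have "\<phi> 0 = 0"
    by simp
  have "\<phi> (c *\<^sub>R x) = c * \<phi> x" if "c \<ge> 0" for c x
  proof (cases "c = 0")
    case False
    with that have "c > 0" by simp
    \<comment> \<open>Scaling back by \<open>inverse c\<close> turns the one-sided estimate into its
      reverse.\<close>
    have "\<phi> (inverse c *\<^sub>R (c *\<^sub>R x)) \<le> inverse c * \<phi> (c *\<^sub>R x)"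
      using that by (intro scale) auto
    with \<open>c > 0\<close> have "c * \<phi> x \<le> \<phi> (c *\<^sub>R x)"
      by (simp add: field_simps)
    then show ?thesis
      using scale[of x "\<phi> x" c] that by simp
  qed (simp add: \<open>\<phi> 0 = 0\<close>)
  then show "sublinear \<phi>"
    using add[OF order.refl order.refl] by (simp add: sublinear_def)
qed

text \<open>The set \<open>{w. a < \<phi> w}\<close> is the slice at height \<open>a\<close> of the
  complement of the epigraph. Conversely, open boxes below the graph fill that complement.\<close>

lemma closed_epigraph_iff_lower_semicontinuous:
  "closed (epigraph UNIV \<phi>) \<longleftrightarrow> lower_semicontinuous \<phi>"
proof
  assume cl: "closed (epigraph UNIV \<phi>)"
  have "\<forall>\<^sub>F w in nhds z. a < \<phi> w" if "a < \<phi> z" for a z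
  proof -
    have "open ((\<lambda>w. (w, a)) -` (- epigraph UNIV \<phi>))"
      using cl by (intro open_vimage continuous_intros) auto
    also have "(\<lambda>w. (w, a)) -` (- epigraph UNIV \<phi>) = {w. a < \<phi> w}"
      by (auto simp: mem_epigraph)
    finally show ?thesis
      using that by (auto simp: eventually_nhds)
  qed
  then show "lower_semicontinuous \<phi>"
    by (simp add: lower_semicontinuous_def)
next
  assume lsc: "lower_semicontinuous \<phi>"
  have "\<exists>S. open S \<and> p \<in> S \<and> S \<subseteq> - epigraph UNIV \<phi>" if "p \<in> - epigraph UNIV \<phi>" for p
  proof -
    obtain z t where p: "p = (z, t)" by fastforce
    with that have "t < \<phi> z" by (simp add: mem_epigraph)
    \<comment> \<open>The intermediate level leaves room to move both \<open>z\<close> and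
      \<open>t\<close>.\<close>
    then obtain a where a: "t < a" "a < \<phi> z" using dense by blast
    with lsc obtain S where "open S" "z \<in> S" "\<forall>w\<in>S. a < \<phi> w"
      unfolding lower_semicontinuous_def eventually_nhds by blast
    then have "open (S \<times> {..<a})" "p \<in> S \<times> {..<a}" "S \<times> {..<a} \<subseteq> - epigraph UNIV \<phi>"
      using a p by (auto simp: open_Times mem_epigraph dest: bspec)
    then show ?thesis
      by blast
  qed
  then show "closed (epigraph UNIV \<phi>)"
    unfolding closed_def by (subst open_subopen) blast
qed

section \<open>Closed convex processes that are epigraphs\<close>

lemma Upsilon_in_convex_processes_iff:
  "Upsilon \<phi> \<in> convex_processes \<longleftrightarrow> lower_semicontinuous \<phi> \<and> sublinear \<phi>"
proof -
  have "(0, \<phi> 0) \<in> epigraph UNIV \<phi>" "\<phi> z \<in> Upsilon \<phi> z" for z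
    by (simp_all add: mem_epigraph mem_Upsilon)
  then have "epigraph UNIV \<phi> \<noteq> {}" "\<forall>z. Upsilon \<phi> z \<noteq> {}"
    by blast+
  then show ?thesis
    unfolding convex_processes_def mem_Collect_eq Gph_Upsilon
    using convex_cone_epigraph_iff_sublinear[of \<phi>]
      closed_epigraph_iff_lower_semicontinuous[of \<phi>] by auto
qed

text \<open>The point \<open>(0, 1)\<close> is in the core: in direction \<open>(x, s)\<close>,
  positive homogeneity reduces membership to \<open>t * (\<phi> x - s) \<le> 1\<close>, which holds
  for small \<open>t \<ge> 0\<close>.\<close>

lemma core_epigraph_nonempty:
  assumes "sublinear \<phi>"
  shows "core (epigraph UNIV \<phi>) \<noteq> {}"
proof -
  have "\<exists>\<delta>>0. \<forall>t\<in>{0..\<delta>}. (0, 1) + t *\<^sub>R p \<in> epigraph UNIV \<phi>" for p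
  proof -
    obtain x s where p: "p = (x, s)" by fastforce
    define \<delta> where "\<delta> = 1 / (1 + \<bar>\<phi> x - s\<bar>)"
    have "\<phi> (t *\<^sub>R x) \<le> 1 + t * s" if "t \<in> {0..\<delta>}" for t
    proof -
      have "t * (\<phi> x - s) \<le> t * (1 + \<bar>\<phi> x - s\<bar>)"
        using that by (intro mult_left_mono) auto
      also have "\<dots> \<le> \<delta> * (1 + \<bar>\<phi> x - s\<bar>)"
        using that by (intro mult_right_mono) auto
      also have "\<dots> = 1"
        by (simp add: \<delta>_def add_nonneg_eq_0_iff)
      finally show ?thesis
        using that sublinear_scaleR[OF assms, of t x] by (simp add: algebra_simps)
    qed
    moreover have "\<delta> > 0"
      by (simp add: \<delta>_def add_pos_nonneg)
    ultimately show ?thesis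
      using p by (auto simp: mem_epigraph intro!: exI[of _ \<delta>])
  qed
  then have "(0, 1) \<in> core (epigraph UNIV \<phi>)"
    unfolding core_def using sublinear_zero[OF assms] by (simp add: mem_epigraph del: split_paired_All)
  then show ?thesis by blast
qed

text \<open>Only the shape of the values is settled here. Lower semicontinuity and sublinearity of
  \<open>\<phi>\<close> then follow from \<open>Upsilon_in_convex_processes_iff\<close>.\<close>

lemma convex_process_eq_Upsilon:
  fixes \<Delta> :: "'z::real_normed_vector \<Rightarrow> real set"
  assumes \<Delta>: "\<Delta> \<in> convex_processes" and "{0..} \<subseteq> \<Delta> 0" and "{..0} \<inter> \<Delta> 0 \<subseteq> {0..}"
  obtains \<phi> where "\<Delta> = Upsilon \<phi>"
proof -
  have "convex (Gph \<Delta>) \<and> cone (Gph \<Delta>)" and cl: "closed (Gph \<Delta>)" and ne: "\<Delta> z \<noteq> {}" for z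
    using \<Delta> by (auto simp: convex_processes_def)
  then have add: "s \<in> \<Delta> x \<Longrightarrow> t \<in> \<Delta> y \<Longrightarrow> s + t \<in> \<Delta> (x + y)" for x y s t
    unfolding convex_cone by (force simp: Gph_def)
  have "t \<in> \<Delta> z \<longleftrightarrow> Inf (\<Delta> z) \<le> t" for t z
  proof -
    have upward: "t \<in> \<Delta> z" if "s \<in> \<Delta> z" "s \<le> t" for s t
    proof -
      have "t - s \<in> \<Delta> 0"
        using that assms(2) by auto
      then show ?thesis
        using add[OF that(1), of "t - s" 0] by simp
    qed
    obtain w where "w \<in> \<Delta> (- z)"
      using ne by blast
    then have "0 \<le> s + w" if "s \<in> \<Delta> z" for s
      using add[OF that, of w "- z"] assms(3) by (cases "s + w \<le> 0") auto
    then have bdd: "bdd_below (\<Delta> z)"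
      by (intro bdd_belowI[of _ "- w"]) (force simp: algebra_simps)
    \<comment> \<open>A value is a slice of the closed graph, so it contains its infimum.\<close>
    have "closed ((\<lambda>t. (z, t)) -` Gph \<Delta>)"
      using cl by (intro closed_vimage continuous_intros)
    then have "closed (\<Delta> z)"
      by (simp add: Gph_def vimage_def)
    then have "Inf (\<Delta> z) \<in> \<Delta> z"
      using closed_contains_Inf[OF ne bdd] by simp
    then show ?thesis
      using upward bdd by (auto intro: cInf_lower)
  qed
  then have "\<Delta> = Upsilon (\<lambda>z. Inf (\<Delta> z))"
    by (intro ext) (simp add: set_eq_iff mem_Upsilon)
  then show ?thesis
    by (rule that)
qed

section \<open>Correspondence between \<open>S_set\<close> and \<open>Gamma_set\<close>\<close>

lemma Upsilon_zero_halfline: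
  assumes "sublinear \<phi>"
  shows "Upsilon \<phi> 0 = {0..}"
  using sublinear_zero[OF assms] by (auto simp: mem_Upsilon)

text \<open>Read forwards and backwards, this serves surjectivity and well-definedness. For
  \<open>z \<noteq> 0\<close> the graph condition is the strict inequality of \<open>S_set\<close>;
  at \<open>z = 0\<close> nondomination leaves only \<open>r = r0\<close>.\<close>

lemma Upsilon_in_Gamma_set_iff:
  assumes nondom: "value_map \<Omega> F G 0 \<inter> {..r0} \<subseteq> {r0..}"
  shows "Upsilon \<phi> \<in> Gamma_set \<Omega> F G r0 \<longleftrightarrow> \<phi> \<in> S_set \<Omega> F G r0"
proof -
  have "Gph (neg_map (Upsilon \<phi>)) \<inter> (\<lambda>p. p - (0, r0)) ` Gph (value_map \<Omega> F G) \<subseteq> {(0, 0)} \<longleftrightarrow>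
        (\<forall>z. z \<noteq> 0 \<longrightarrow> (\<forall>r\<in>value_map \<Omega> F G z. - \<phi> z < r - r0))" (is "?disj \<longleftrightarrow> ?strict")
    if "sublinear \<phi>"
  proof -
    have "y \<in> neg_map (Upsilon \<phi>) z \<longleftrightarrow> y \<le> - \<phi> z" for y z
    proof -
      have "y \<in> neg_map (Upsilon \<phi>) z \<longleftrightarrow> - y \<in> Upsilon \<phi> z"
        unfolding neg_map_def by (metis imageE image_eqI minus_minus)
      then show ?thesis
        by (simp add: mem_Upsilon le_minus_iff)
    qed
    then have "?disj \<longleftrightarrow> (\<forall>z. \<forall>r\<in>value_map \<Omega> F G z. r - r0 \<le> - \<phi> z \<longrightarrow> z = 0 \<and> r = r0)"
      by (simp add: Gph_def subset_iff image_iff) (metis add_diff_cancel diff_add_cancel diff_self)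
    moreover have "r = r0" if "r \<in> value_map \<Omega> F G 0" "r - r0 \<le> - \<phi> 0" for r
      using that nondom sublinear_zero[OF \<open>sublinear \<phi>\<close>] by fastforce
    ultimately show ?thesis
      by (metis linorder_not_le)
  qed
  moreover have "core (Gph (Upsilon \<phi>)) \<noteq> {}" if "sublinear \<phi>"
    using core_epigraph_nonempty[OF that] by (simp add: Gph_Upsilon)
  ultimately show ?thesis
    unfolding Gamma_set_def S_set_def mem_Collect_eq Upsilon_in_convex_processes_iff
    by (fold value_map_def) (auto simp: Upsilon_zero_halfline)
qed

section \<open>Finite norm and interior of the graph\<close>

lemma process_norm_Upsilon_finite_iff:
  "process_norm (Upsilon \<phi>) < \<infinity> \<longleftrightarrow> (\<exists>M. \<forall>z\<in>cball 0 1. \<phi> z \<le> M)"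
proof
  assume "process_norm (Upsilon \<phi>) < \<infinity>"
  \<comment> \<open>The bound is strict so that each infimum below it yields an actual
    \<open>y \<ge> \<phi> z\<close> with \<open>\<bar>y\<bar> < M\<close>.\<close>
  then obtain M where M: "process_norm (Upsilon \<phi>) < ereal M"
    using less_PInf_Ex_of_nat by auto
  have "\<phi> z \<le> M" if "z \<in> cball 0 1" for z
  proof -
    have "(INF y\<in>Upsilon \<phi> z. ereal \<bar>y\<bar>) \<le> process_norm (Upsilon \<phi>)"
      unfolding process_norm_def using that by (rule SUP_upper)
    with M have "(INF y\<in>Upsilon \<phi> z. ereal \<bar>y\<bar>) < ereal M"
      by simp
    then show ?thesis
      by (auto simp: INF_less_iff mem_Upsilon)
  qed
  then show "\<exists>M. \<forall>z\<in>cball 0 1. \<phi> z \<le> M" by blast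
next
  assume "\<exists>M. \<forall>z\<in>cball 0 1. \<phi> z \<le> M"
  then obtain M where M: "\<And>z. z \<in> cball 0 1 \<Longrightarrow> \<phi> z \<le> M" by blast
  have "process_norm (Upsilon \<phi>) \<le> ereal \<bar>M\<bar>"
    unfolding process_norm_def
  proof (rule SUP_least)
    fix z :: 'a assume "z \<in> cball 0 1"
    then have "M \<in> Upsilon \<phi> z" using M by (simp add: mem_Upsilon)
    then show "(INF y\<in>Upsilon \<phi> z. ereal \<bar>y\<bar>) \<le> ereal \<bar>M\<bar>"
      by (rule INF_lower)
  qed
  then show "process_norm (Upsilon \<phi>) < \<infinity>"
    by (rule le_less_trans) simp
qed

lemma interior_epigraph_nonempty:
  fixes \<phi> :: "'z::real_normed_vector \<Rightarrow> real"
  assumes "\<And>z. z \<in> cball 0 1 \<Longrightarrow> \<phi> z \<le> M"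
  shows "interior (epigraph UNIV \<phi>) \<noteq> {}"
proof -
  have "ball 0 1 \<times> {M<..} \<subseteq> epigraph UNIV \<phi>"
  proof clarify
    fix z :: 'z and t :: real
    assume "z \<in> ball 0 1" "M < t"
    then show "(z, t) \<in> epigraph UNIV \<phi>"
      using assms[of z] by (simp add: mem_epigraph)
  qed
  moreover have "open (ball (0::'z) 1 \<times> {M<..})"
    by (intro open_Times) auto
  moreover have "(0, M + 1) \<in> ball (0::'z) 1 \<times> {M<..}"
    by simp
  ultimately have "(0, M + 1) \<in> interior (epigraph UNIV \<phi>)"
    by (rule interiorI[rotated 2])
  then show ?thesis by blast
qed

text \<open>Completeness is a premise on \<open>UNIV\<close> instead of a type class, so that the
  theorem can state it as an implication about the same space.\<close>

lemma lower_semicontinuous_sublinear_bounded_above: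
  fixes \<phi> :: "'z::real_normed_vector \<Rightarrow> real"
  assumes lsc: "lower_semicontinuous \<phi>" and sub: "sublinear \<phi>" and "complete (UNIV :: 'z set)"
  shows "\<exists>M. \<forall>z\<in>cball 0 1. \<phi> z \<le> M"
proof -
  define A where "A n = {z. \<phi> z \<le> real n}" for n
  have cl: "closed (A n)" for n
  proof -
    have "closed ((\<lambda>z. (z, real n)) -` epigraph UNIV \<phi>)"
      using lsc by (intro closed_vimage continuous_intros)
        (simp add: closed_epigraph_iff_lower_semicontinuous)
    then show ?thesis
      by (simp add: A_def vimage_def mem_epigraph)
  qed
  have "(\<Union>n. A n) = UNIV"
    by (auto simp: A_def real_arch_simple)
  then have "interior (\<Union>n. A n) \<noteq> {}"
    by simp
  then obtain n where "interior (A n) \<noteq> {}"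
    using Met_TC.metric_Baire_category_alt[of "range A"] cl assms(3) by auto
  then obtain a e where "e > 0" and ball: "cball a e \<subseteq> A n"
    by (metis ex_in_conv mem_interior_cball)
  \<comment> \<open>Write \<open>e *\<^sub>R z\<close> as
    \<open>(a + e *\<^sub>R z) + (- a)\<close>: the first summand stays in the ball, where
    \<open>\<phi>\<close> is at most \<open>n\<close>.\<close>
  have "\<phi> z \<le> inverse e * (real n + \<phi> (- a))" if "z \<in> cball 0 1" for z
  proof -
    have "a + e *\<^sub>R z \<in> cball a e"
      using that \<open>e > 0\<close> by (simp add: dist_norm)
    then have "\<phi> (a + e *\<^sub>R z) \<le> real n"
      using ball by (auto simp: A_def)
    moreover have "e * \<phi> z \<le> \<phi> (a + e *\<^sub>R z) + \<phi> (- a)"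
      using sublinear_add[OF sub, of "a + e *\<^sub>R z" "- a"] sublinear_scaleR[OF sub, of e z] \<open>e > 0\<close>
      by simp
    ultimately show ?thesis
      using \<open>e > 0\<close> by (simp add: field_simps)
  qed
  then show ?thesis by blast
qed

theorem proposition3p11:
  fixes \<Omega> :: "'x::real_normed_vector set"
    and F :: "'x \<Rightarrow> real set"
    and G :: "'x \<Rightarrow> 'z::real_normed_vector set"
    and U :: "'z set"
    and r0 :: real
  assumes "open U" and "0 \<in> U"
    and "\<forall>z\<in>U. value_map \<Omega> F G z \<noteq> {}"
    and "value_map \<Omega> F G 0 \<inter> {..r0} \<subseteq> {r0..}"
  shows "(\<forall>\<phi>\<in>S_set \<Omega> F G r0. Upsilon \<phi> \<in> Gamma_set \<Omega> F G r0)
    \<and> bij_betw Upsilon (S_set \<Omega> F G r0) (Gamma_set \<Omega> F G r0)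
    \<and> (\<forall>\<phi>\<in>S_set \<Omega> F G r0.
          (process_norm (Upsilon \<phi>) < \<infinity> \<longrightarrow> interior (Gph (Upsilon \<phi>)) \<noteq> {})
          \<and> (complete (UNIV :: 'z set) \<longrightarrow> process_norm (Upsilon \<phi>) < \<infinity>))"
proof (intro conjI ballI impI)
  note mem_Gamma = Upsilon_in_Gamma_set_iff[OF assms(4)]
  fix \<phi> assume \<phi>: "\<phi> \<in> S_set \<Omega> F G r0"
  then show "Upsilon \<phi> \<in> Gamma_set \<Omega> F G r0"
    by (simp add: mem_Gamma)
  show "interior (Gph (Upsilon \<phi>)) \<noteq> {}" if "process_norm (Upsilon \<phi>) < \<infinity>"
    using that interior_epigraph_nonempty
    unfolding process_norm_Upsilon_finite_iff Gph_Upsilon by blast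
  show "process_norm (Upsilon \<phi>) < \<infinity>" if "complete (UNIV :: 'z set)"
    using \<phi> that lower_semicontinuous_sublinear_bounded_above
    unfolding process_norm_Upsilon_finite_iff S_set_def by blast
next
  note mem_Gamma = Upsilon_in_Gamma_set_iff[OF assms(4)]
  \<comment> \<open>Surjectivity: the process is some \<open>Upsilon \<phi>\<close>, and the
    membership equivalence puts \<open>\<phi>\<close> in \<open>S_set\<close>.\<close>
  have "\<Delta> \<in> Upsilon ` S_set \<Omega> F G r0" if \<Delta>: "\<Delta> \<in> Gamma_set \<Omega> F G r0" for \<Delta>
  proof -
    obtain \<phi> where "\<Delta> = Upsilon \<phi>"
      using \<Delta> convex_process_eq_Upsilon unfolding Gamma_set_def by blast
    then show ?thesis
      using \<Delta> mem_Gamma by blast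
  qed
  then show "bij_betw Upsilon (S_set \<Omega> F G r0) (Gamma_set \<Omega> F G r0)"
    using inj_Upsilon mem_Gamma by (auto simp: bij_betw_def intro: inj_on_subset)
qed

end
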